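(* For any $n\ge1$, we have $|\mathbf{I}_n(001,210)|=\binom{n}{3}+n$.
   Context: An inversion sequence of length $n$ is an integer sequence $e=(e_1,\dots,e_n)$ with $0\le e_i\le i-1$ for all $1\le i\le n$. A word $w_1\cdots w_n$ avoids a pattern $P=p_1\cdots p_k$ if there are no $i_1<\cdots<i_k$ such that $w_{i_1}\cdots w_{i_k}$ is order isomorphic to $P$ (equal letters of $P$ corresponding to equal entries). $\mathbf{I}_n(P_1,P_2)$ denotes the set of inversion sequences of length $n$ avoiding both $P_1$ and $P_2$. *)

theory Defs
  imports Main "HOL-Library.Sublist"
begin

(* Lists are indexed from 0, so the entry e_i of the paper is e ! (i - 1)
   and the condition 0 <= e_i <= i - 1 becomes e ! i <= i. *)
definition inversion_sequences :: "nat \<Rightarrow> nat list set" where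
  "inversion_sequences n = {e. length e = n \<and> (\<forall>i<n. e ! i \<le> i)}"

(* As i and j range over all ordered pairs, the condition on < also forces
   u ! i = u ! j exactly when p ! i = p ! j. *)
definition order_isomorphic :: "'a::linorder list \<Rightarrow> 'b::linorder list \<Rightarrow> bool" where
  "order_isomorphic u p \<longleftrightarrow>
     length u = length p \<and>
     (\<forall>i<length p. \<forall>j<length p. u ! i < u ! j \<longleftrightarrow> p ! i < p ! j)"

definition avoids :: "'a::linorder list \<Rightarrow> 'b::linorder list \<Rightarrow> bool" where
  "avoids w p \<longleftrightarrow> \<not> (\<exists>u. subseq u w \<and> order_isomorphic u p)"

definition avoiding_inversion_sequences ::
    "nat \<Rightarrow> nat list \<Rightarrow> nat list \<Rightarrow> nat list set" where
  "avoiding_inversion_sequences n p q =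
     {e \<in> inversion_sequences n. avoids e p \<and> avoids e q}"

end

theory Submission
  imports Defs
begin

text \<open>
  Let \<open>e\<close> be an inversion sequence avoiding 001 and 210, and let \<open>a\<close> be the last index such that
  \<open>e ! i = i\<close> for all \<open>i \<le> a\<close>. The next entry, if there is one, is at
  most \<open>a\<close>, so it repeats an earlier entry, and
  001-avoidance then bounds everything after it by its value. Hence each entry after position \<open>a\<close>
  is again a repetition, and these entries form a weakly decreasing word with letters in
  \<open>{0, \<dots>, a}\<close>. Since position \<open>a\<close> itself holds the letter \<open>a\<close>, 210-avoidance allows this
  decreasing tail to use at most one letter smaller than \<open>a\<close>. So \<open>e\<close> climbs \<open>0, 1, \<dots>, a\<close>, stays at
  \<open>a\<close> for a while, and then possibly drops once to some \<open>b < a\<close>, at a position \<open>p > a\<close>, and stays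
  there.

  Conversely all these words avoid both patterns. Those without a drop are determined by
  \<open>a < n\<close>, which accounts for the summand \<open>n\<close>; those with a drop are determined by the triple
  \<open>b < a < p < n\<close>, that is, by a 3-subset of \<open>{0, \<dots>, n - 1}\<close>, which accounts for
  \<open>n choose 3\<close>.
\<close>

section \<open>Avoidance in terms of positions\<close>

lemma subseq_Cons_iff_nth:
  "subseq (x # xs) ys \<longleftrightarrow> (\<exists>i<length ys. ys ! i = x \<and> subseq xs (drop (Suc i) ys))"
proof
  assume "subseq (x # xs) ys"
  then obtain us vs where "ys = us @ x # vs" "subseq xs vs"
    by (auto dest: list_emb_ConsD)
  then show "\<exists>i<length ys. ys ! i = x \<and> subseq xs (drop (Suc i) ys)"
    by (intro exI[of _ "length us"]) auto
next
  assume "\<exists>i<length ys. ys ! i = x \<and> subseq xs (drop (Suc i) ys)"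
  then obtain i where i: "i < length ys" "ys ! i = x" "subseq xs (drop (Suc i) ys)"
    by blast
  then have "subseq (x # xs) (drop i ys)"
    by (simp add: Cons_nth_drop_Suc[symmetric])
  then show "subseq (x # xs) ys"
    by (rule subseq_order.trans) (rule suffix_imp_subseq[OF suffix_drop])
qed

lemma subseq_triple_iff_nth:
  "subseq [x, y, z] w \<longleftrightarrow>
     (\<exists>i j k. i < j \<and> j < k \<and> k < length w \<and> w ! i = x \<and> w ! j = y \<and> w ! k = z)"
  (is "_ \<longleftrightarrow> ?R")
proof
  assume "subseq [x, y, z] w"
  then obtain i j k where
    "i < length w" "w ! i = x"
    "Suc (i + j) < length w" "w ! Suc (i + j) = y"
    "Suc (Suc (i + j + k)) < length w" "w ! Suc (Suc (i + j + k)) = z"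
    by (auto simp: subseq_Cons_iff_nth less_diff_conv add_ac)
  then show ?R
    by (intro exI[of _ i] exI[of _ "Suc (i + j)"] exI[of _ "Suc (Suc (i + j + k))"]) auto
next
  assume ?R
  then obtain i j k where ijk: "i < j" "j < k" "k < length w"
    and [simp]: "w ! i = x" "w ! j = y" "w ! k = z" by blast
  have "subseq [z] (drop (Suc j) w)"
    using ijk by (subst subseq_Cons_iff_nth) (auto intro!: exI[of _ "k - Suc j"])
  then have "subseq [y, z] (drop (Suc i) w)"
    using ijk by (subst subseq_Cons_iff_nth) (auto intro!: exI[of _ "j - Suc i"])
  then show "subseq [x, y, z] w"
    using ijk by (subst subseq_Cons_iff_nth) (auto intro!: exI[of _ i])
qed

lemma avoids_triple_iff:
  "avoids w [p, q, r] \<longleftrightarrow>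
     (\<forall>i j k. i < j \<longrightarrow> j < k \<longrightarrow> k < length w \<longrightarrow>
        \<not> order_isomorphic [w ! i, w ! j, w ! k] [p, q, r])"
proof -
  have "avoids w [p, q, r] \<longleftrightarrow>
      (\<forall>x y z. subseq [x, y, z] w \<longrightarrow> \<not> order_isomorphic [x, y, z] [p, q, r])"
    unfolding avoids_def order_isomorphic_def
    by (auto simp: length_Suc_conv)
  then show ?thesis
    unfolding subseq_triple_iff_nth by blast
qed

lemma avoids_001_iff:
  "avoids w [0::nat, 0, 1] \<longleftrightarrow>
     (\<forall>i j k. i < j \<longrightarrow> j < k \<longrightarrow> k < length w \<longrightarrow> w ! i = w ! j \<longrightarrow> w ! k \<le> w ! j)"
proof -
  have "order_isomorphic [x, y, z] [0::nat, 0, 1] \<longleftrightarrow> x = y \<and> y < z" for x y z :: 'a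
    by (auto simp: order_isomorphic_def All_less_Suc numeral_3_eq_3)
  then show ?thesis
    by (auto simp: avoids_triple_iff not_less)
qed

lemma avoids_210_iff:
  "avoids w [2::nat, 1, 0] \<longleftrightarrow>
     (\<forall>i j k. i < j \<longrightarrow> j < k \<longrightarrow> k < length w \<longrightarrow> w ! j < w ! i \<longrightarrow> w ! j \<le> w ! k)"
proof -
  have "order_isomorphic [x, y, z] [2::nat, 1, 0] \<longleftrightarrow> y < x \<and> z < y" for x y z :: 'a
    by (auto simp: order_isomorphic_def All_less_Suc numeral_3_eq_3)
  then show ?thesis
    by (simp add: avoids_triple_iff) (meson not_less)
qed

section \<open>The shape of the avoiding sequences\<close>

definition plateau_word :: "nat \<Rightarrow> nat \<Rightarrow> nat list" where
  "plateau_word n a = map (\<lambda>i. min i a) [0..<n]"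

definition drop_word :: "nat \<Rightarrow> nat \<Rightarrow> nat \<Rightarrow> nat \<Rightarrow> nat list" where
  "drop_word n p a b = map (\<lambda>i. if i < p then min i a else b) [0..<n]"

lemma plateau_word_avoiding:
  "plateau_word n a \<in> avoiding_inversion_sequences n [0, 0, 1] [2, 1, 0]"
  unfolding avoiding_inversion_sequences_def inversion_sequences_def
    avoids_001_iff avoids_210_iff plateau_word_def
  by auto

lemma drop_word_avoiding:
  assumes "b < a" "a < p"
  shows "drop_word n p a b \<in> avoiding_inversion_sequences n [0, 0, 1] [2, 1, 0]"
  unfolding avoiding_inversion_sequences_def inversion_sequences_def
    avoids_001_iff avoids_210_iff drop_word_def
  using assms by (auto simp: min_def split: if_splits)

text \<open>
  Comparing an entry after the initial staircase with its earlier copy \<open>e ! (e ! i) = e ! i\<close> turns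
  001-avoidance into monotonicity of the tail, and comparing with the top \<open>e ! a = a\<close> turns
  210-avoidance into constancy below \<open>a\<close>.
\<close>

lemma avoiding_cases:
  assumes e: "e \<in> avoiding_inversion_sequences n [0, 0, 1] [2, 1, 0]" and "n \<ge> 1"
  obtains (plateau) a where "a < n" "e = plateau_word n a"
  | (drop) p a b where "b < a" "a < p" "p < n" "e = drop_word n p a b"
proof -
  have len: "length e = n" and le: "\<And>i. i < n \<Longrightarrow> e ! i \<le> i"
    and av001: "\<And>i j k. i < j \<Longrightarrow> j < k \<Longrightarrow> k < n \<Longrightarrow> e ! i = e ! j \<Longrightarrow> e ! k \<le> e ! j"
    and av210: "\<And>i j k. i < j \<Longrightarrow> j < k \<Longrightarrow> k < n \<Longrightarrow> e ! j < e ! i \<Longrightarrow> e ! j \<le> e ! k"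
    using e unfolding avoiding_inversion_sequences_def inversion_sequences_def
      avoids_001_iff avoids_210_iff by auto
  let ?P = "\<lambda>a. a < n \<and> (\<forall>i\<le>a. e ! i = i)"
  define a where "a = (GREATEST a. ?P a)"
  have bound: "\<And>y. ?P y \<Longrightarrow> y \<le> n" by simp
  have "?P 0" using le[of 0] \<open>n \<ge> 1\<close> by simp
  then have "?P a" unfolding a_def by (rule GreatestI_nat[OF _ bound])
  then have an: "a < n" and stair: "\<And>i. i \<le> a \<Longrightarrow> e ! i = i" by auto
  have "\<not> ?P (Suc a)"
    using Greatest_le_nat[of ?P "Suc a", OF _ bound] unfolding a_def[symmetric] by auto
  then have Suc_a: "e ! Suc a \<le> a" if "Suc a < n"
    using that stair le[of "Suc a"] by (metis le_SucE)
  have repeat: "e ! j \<le> e ! i" if "i < j" "j < n" "a < i" "e ! i \<le> a" for i j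
    using av001[of "e ! i" i j] stair[of "e ! i"] that by simp
  have tail_le: "e ! j \<le> a" if "a < j" "j < n" for j
    using repeat[of "Suc a" j] Suc_a that by (cases "j = Suc a") auto
  show thesis
  proof (cases "\<forall>j. a < j \<longrightarrow> j < n \<longrightarrow> e ! j = a")
    case True
    have "e = plateau_word n a"
      unfolding plateau_word_def using True stair len
      by (intro nth_equalityI) (auto simp: min_def)
    with an show thesis by (rule plateau)
  next
    case False
    let ?Q = "\<lambda>j. a < j \<and> j < n \<and> e ! j \<noteq> a"
    define p where "p = (LEAST j. ?Q j)"
    have "\<exists>j. ?Q j" using False by blast
    then have "?Q p" unfolding p_def by (rule LeastI_ex)
    then have p: "a < p" "p < n" "e ! p < a"
      using tail_le[of p] by auto
    have before: "e ! j = a" if "a < j" "j < p" for j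
      using not_less_Least[of j ?Q] that p unfolding p_def[symmetric] by auto
    have after: "e ! j = e ! p" if "p < j" "j < n" for j
    proof (rule antisym)
      show "e ! j \<le> e ! p" using repeat[of p j] that p by simp
      show "e ! p \<le> e ! j" using av210[of a p j] stair[of a] that p by simp
    qed
    obtain b where b: "e ! p = b" by blast
    have "e ! i = (if i < p then min i a else b)" if "i < n" for i
      using that p b stair[of i] before[of i] after[of i]
      by (cases "i = p") (auto simp: min_def not_less)
    then have "e = drop_word n p a b"
      unfolding drop_word_def using len by (intro nth_equalityI) auto
    with p b show thesis by (intro drop) auto
  qed
qed

section \<open>Counting\<close>

text \<open>
  Listing the largest component first makes each range depend only on the preceding component, so
  that the cardinality is an iterated sum, evaluated by two applications of the hockey-stick
  identity.
\<close>

definition drop_params :: "nat \<Rightarrow> (nat \<times> nat \<times> nat) set" where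
  "drop_params n = (SIGMA p:{..<n}. SIGMA a:{..<p}. {..<a})"

lemma card_drop_params: "card (drop_params n) = n choose 3"
proof -
  have pairs: "(\<Sum>a<p. a) = p choose 2" for p :: nat
    by (induction p) (auto simp: numeral_2_eq_2)
  have "(\<Sum>p<n. p choose 2) = n choose 3"
    by (induction n) (auto simp: numeral_2_eq_2 numeral_3_eq_3)
  then show ?thesis
    by (simp add: drop_params_def pairs)
qed

lemma avoiding_eq_Un:
  assumes "n \<ge> 1"
  shows "avoiding_inversion_sequences n [0, 0, 1] [2, 1, 0] =
    (\<lambda>(p, a, b). drop_word n p a b) ` drop_params n \<union> plateau_word n ` {..<n}"
    (is "?A = ?D \<union> ?P")
proof
  show "?A \<subseteq> ?D \<union> ?P"
  proof
    fix e assume "e \<in> ?A"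
    then show "e \<in> ?D \<union> ?P"
      using assms by (cases rule: avoiding_cases) (force simp: drop_params_def)+
  qed
  show "?D \<union> ?P \<subseteq> ?A"
    using plateau_word_avoiding drop_word_avoiding by (auto simp: drop_params_def)
qed

lemma inj_on_plateau_word: "inj_on (plateau_word n) {..<n}"
proof (rule inj_onI)
  fix a a' assume "a \<in> {..<n}" "a' \<in> {..<n}" "plateau_word n a = plateau_word n a'"
  then have "plateau_word n a ! (n - 1) = plateau_word n a' ! (n - 1)" "a < n" "a' < n" by auto
  then show "a = a'" by (simp add: plateau_word_def)
qed

lemma drop_word_eq_nth:
  assumes "drop_word n p a b = drop_word n p' a' b'" "i < n"
  shows "(if i < p then min i a else b) = (if i < p' then min i a' else b')"
  using arg_cong[OF assms(1), of "\<lambda>w. w ! i"] assms(2) by (simp add: drop_word_def cong: if_cong)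

text \<open>
  The last letter of the word is \<open>b\<close>, the staircase ends just before the first position where the
  word differs from the identity, and \<open>p\<close> is the first later position where the letter is not \<open>a\<close>.
\<close>

lemma drop_word_inject:
  assumes "b < a" "a < p" "p < n" and "b' < a'" "a' < p'" "p' < n"
    and eq: "drop_word n p a b = drop_word n p' a' b'"
  shows "p = p' \<and> a = a' \<and> b = b'"
proof -
  note at = drop_word_eq_nth[OF eq]
  have b: "b = b'"
    using at[of "n - 1"] assms(1-6) by (simp split: if_splits)
  have a: "a = a'"
    using at[of "Suc a"] at[of "Suc a'"] assms(1-6)
    by (cases a a' rule: linorder_cases) (auto split: if_splits)
  have "p = p'"
    using at[of p] at[of p'] assms(1-6) a
    by (cases p p' rule: linorder_cases) (auto split: if_splits)
  with a b show ?thesis by simp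
qed

lemma inj_on_drop_word: "inj_on (\<lambda>(p, a, b). drop_word n p a b) (drop_params n)"
  using drop_word_inject by (fastforce simp: inj_on_def drop_params_def)

lemma drop_word_neq_plateau_word:
  assumes "b < a" "a < p" "p < n"
  shows "drop_word n p a b \<noteq> plateau_word n c"
proof
  assume "drop_word n p a b = plateau_word n c"
  then have "drop_word n p a b ! i = plateau_word n c ! i" for i by simp
  \<comment> \<open>A plateau word never descends, but the drop word has \<open>a\<close> at position \<open>a\<close> and \<open>b\<close> at \<open>p\<close>.\<close>
  from this[of a] this[of p] show False
    using assms by (simp add: drop_word_def plateau_word_def)
qed

theorem theorem2p12:
  fixes n :: nat
  assumes "n \<ge> 1"
  shows "card (avoiding_inversion_sequences n [0, 0, 1] [2, 1, 0]) = (n choose 3) + n"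
proof -
  let ?D = "(\<lambda>(p, a, b). drop_word n p a b) ` drop_params n"
  let ?P = "plateau_word n ` {..<n}"
  have "finite ?D" "finite ?P"
    by (auto simp: drop_params_def)
  moreover have "?D \<inter> ?P = {}"
    using drop_word_neq_plateau_word by (fastforce simp: drop_params_def)
  ultimately have "card (?D \<union> ?P) = card ?D + card ?P"
    by (rule card_Un_disjoint)
  also have "\<dots> = (n choose 3) + n"
    by (simp add: card_image inj_on_drop_word inj_on_plateau_word card_drop_params)
  finally show ?thesis
    using avoiding_eq_Un[OF assms] by simp
qed

end
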